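(* Let $m,n\ge 1$ be integers such that $n=m$ or $n=m+1$. Let $q_0,q_1,\dots,q_{m-1}\in\mathbb{R}[y]$ and $p_0,p_1,\dots,p_{n-2}\in\mathbb{R}[x]$ be monic polynomials with $\deg q_j=j$ and $\deg p_j=j$ for all $j$ (so $q_0=1$ and $p_0=1$; the list of $p_j$ is empty if $n=1$). Let $P\in\mathbb{R}^{m\times n}[x]$ and $Q\in\mathbb{R}^{m\times n}[y]$ be polynomial matrices such that $$Q_{i,j}(y)=q_{j-1}(y)\quad\text{for all } 1\le j\le i\le m,$$ $$P_{i,j}(x)=p_{i-1}(x)\quad\text{for all } 1\le i\le m,\ i<j\le n,$$ while all remaining entries of $Q$ (those with $j>i$) and of $P$ (those with $j\le i$) are arbitrary real polynomials in $y$, respectively in $x$ (not necessarily equal to each other). That is, the lower triangular part of $Q$ including the main diagonal has constant columns, and the strictly upper triangular part of $P$ has constant rows. Then for $\mathcal{X}=\{x_1,\dots,x_m\}\subset\mathbb{R}$ and $\mathcal{Y}=\{y_1,\dots,y_n\}\subset\mathbb{R}$, $$\operatorname{vdm}(\mathcal{X}\times\mathcal{Y},\,P\circ Q)=\pm\left(\prod_{j=1}^{n}\operatorname{vdm}(\mathcal{X},P_{:,j})\right)\cdot\left(\prod_{i=1}^{m}\operatorname{vdm}(\mathcal{Y},Q_{i,:})\right).$$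
   Context: $\mathbb{R}^{m\times n}[\mathbf{z}]$ denotes the $m\times n$ matrices whose entries are real polynomials in the variables $\mathbf{z}$. For $P\in\mathbb{R}^{m\times n}[x]$ and $Q\in\mathbb{R}^{m\times n}[y]$, $P\circ Q\in\mathbb{R}^{m\times n}[x,y]$ is the Hadamard (entrywise) product, $(P\circ Q)_{i,j}(x,y)=P_{i,j}(x)Q_{i,j}(y)$. $P_{:,j}$ is the $j$-th column and $Q_{i,:}$ the $i$-th row. For a family of $N$ polynomials $\mathcal{P}=\{f_1,\dots,f_N\}$ and a family of $N$ points $\mathcal{A}=\{\mathbf{a}_1,\dots,\mathbf{a}_N\}$, $\operatorname{vdm}(\mathcal{A},\mathcal{P})=\det\,[f_j(\mathbf{a}_i)]_{i,j=1}^{N}$. For a polynomial matrix $R$ (in particular a row or column), $\operatorname{vdm}(\mathcal{A},R)$ means $\operatorname{vdm}$ with respect to the family of all entries of $R$ (listed by their indices). The orderings of points and of polynomials are arbitrary; they affect $\operatorname{vdm}$ only by a sign, and "$\pm$" means the equality holds up to sign, i.e. the absolute values agree. $\mathcal{X}\times\mathcal{Y}$ is the family of the $mn$ points $(x_i,y_j)$. *)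

theory Defs
  imports
    "HOL-Computational_Algebra.Polynomial"
    "HOL-Combinatorics.List_Permutation"
    "Jordan_Normal_Form.Determinant"
begin

text \<open>
  The ring \<open>\<real>[x,y]\<close> is represented as \<open>real poly poly\<close>, i.e. as \<open>(\<real>[x])[y]\<close>: the
  coefficients are polynomials in \<open>x\<close> and the outer variable is \<open>y\<close>.
\<close>

definition in_x :: "real poly \<Rightarrow> real poly poly"
  where "in_x f = [:f:]"

definition in_y :: "real poly \<Rightarrow> real poly poly"
  where "in_y g = map_poly (\<lambda>c. [:c:]) g"

definition poly_xy :: "real poly poly \<Rightarrow> real \<times> real \<Rightarrow> real"
  where "poly_xy f = (\<lambda>(x, y). poly (map_poly (\<lambda>c. poly c x) f) y)"

lemma poly_xy_in_x_mult_in_y: "poly_xy (in_x f * in_y g) (x, y) = poly f x * poly g y"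
proof -
  have "map_poly (\<lambda>c. poly c x) (in_x f * in_y g) = smult (poly f x) g"
    by (rule poly_eqI) (simp add: in_x_def in_y_def coeff_map_poly)
  then show ?thesis
    by (simp add: poly_xy_def)
qed

text \<open>The entrywise product; it is only meaningful when \<open>P\<close> and \<open>Q\<close> have equal dimensions.\<close>

definition hadamard_xy :: "real poly mat \<Rightarrow> real poly mat \<Rightarrow> real poly poly mat"
  where "hadamard_xy P Q =
    mat (dim_row Q) (dim_col Q) (\<lambda>(i, j). in_x (P $$ (i, j)) * in_y (Q $$ (i, j)))"

definition mat_entries :: "'a mat \<Rightarrow> 'a list"
  where "mat_entries R = concat (mat_to_list R)"

text \<open>
  Families are lists, so repetitions are allowed. The parameter \<open>ev\<close> evaluates a polynomial
  at a point: \<^const>\<open>poly\<close> for one variable, \<^const>\<open>poly_xy\<close> for two. The value is only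
  meaningful when the two lists have equal length.
\<close>

definition vdm :: "('p \<Rightarrow> 'a \<Rightarrow> real) \<Rightarrow> 'a list \<Rightarrow> 'p list \<Rightarrow> real"
  where "vdm ev as fs = det (mat (length as) (length fs) (\<lambda>(i, j). ev (fs ! j) (as ! i)))"

text \<open>Up to sign, the order in which points and polynomials are listed is irrelevant.\<close>

lemma abs_vdm_permute_points:
  assumes "mset as = mset as'" and len: "length as = length fs"
  shows "\<bar>vdm ev as fs\<bar> = \<bar>vdm ev as' fs\<bar>"
proof -
  obtain p where p: "p permutes {..<length as'}" "permute_list p as' = as"
    using assms(1) by (rule mset_eq_permutation)
  have l: "length as' = length fs"
    using assms mset_eq_length by metis
  let ?B = "mat (length as') (length fs) (\<lambda>(i, j). ev (fs ! j) (as' ! i))"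
  have B: "?B \<in> carrier_mat (length fs) (length fs)"
    using l by simp
  have p': "p permutes {0..<length fs}"
    using p(1) l by (simp add: lessThan_atLeast0)
  have lt: "p i < length fs" if "i < length fs" for i
    using permutes_in_image[OF p', of i] that by simp
  have "mat (length as) (length fs) (\<lambda>(i, j). ev (fs ! j) (as ! i))
      = mat (length fs) (length fs) (\<lambda>(i, j). ?B $$ (p i, j))"
    using p len l lt by (intro eq_matI) (auto simp: permute_list_nth)
  then have "vdm ev as fs = signof p * vdm ev as' fs"
    using det_permute_rows[OF B p'] by (simp add: vdm_def)
  then show ?thesis
    by (simp add: abs_mult sign_def)
qed

lemma abs_vdm_permute_polys:
  assumes "mset fs = mset fs'" and len: "length as = length fs"
  shows "\<bar>vdm ev as fs\<bar> = \<bar>vdm ev as fs'\<bar>"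
proof -
  have tr: "vdm ev as gs = vdm (\<lambda>a f. ev f a) gs as" if "length as = length gs" for gs
  proof -
    let ?A = "mat (length as) (length gs) (\<lambda>(i, j). ev (gs ! j) (as ! i))"
    have A: "?A \<in> carrier_mat (length gs) (length gs)"
      using that by simp
    have "transpose_mat ?A = mat (length gs) (length as) (\<lambda>(i, j). ev (gs ! i) (as ! j))"
      by (rule eq_matI) auto
    then show ?thesis
      using det_transpose[OF A] by (simp add: vdm_def)
  qed
  have "length fs' = length fs"
    using assms(1) mset_eq_length by metis
  then show ?thesis
    using abs_vdm_permute_points[OF assms(1), of as "\<lambda>a f. ev f a"] len tr by simp
qed

end

theory Submission
  imports Defs
begin

text \<open>
  The proof is block elimination with respect to one point \<open>y\<^sub>0\<close> of \<open>\<Y>\<close>, indices starting at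
  \<open>0\<close>. Since \<open>q\<^sub>0 = 1\<close>, the entries in the first column of \<open>P \<circ> Q\<close> depend on \<open>x\<close> only.
  Subtracting the row of the point \<open>(x\<^sub>a, y\<^sub>0)\<close> from that of \<open>(x\<^sub>a, y\<^sub>b)\<close> for every \<open>b > 0\<close>
  therefore produces a zero block, and the determinant splits
  (\<open>vdm_eliminate_block\<close>): one factor is \<open>vdm(\<X>, P\<^sub>:\<^sub>,\<^sub>0)\<close>, and in the other one
  \<open>Q\<^sub>i\<^sub>j(y\<^sub>b)\<close> has become \<open>Q\<^sub>i\<^sub>j(y\<^sub>b) - Q\<^sub>i\<^sub>j(y\<^sub>0) = (y\<^sub>b - y\<^sub>0) Q'\<^sub>i\<^sub>j(y\<^sub>b)\<close>, with \<open>Q'\<^sub>i\<^sub>j\<close> the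
  quotient of \<open>Q\<^sub>i\<^sub>j\<close> by \<open>y - y\<^sub>0\<close>. The factors \<open>y\<^sub>b - y\<^sub>0\<close> come out of the rows. The same
  elimination, applied to the one-variable determinant of a row of \<open>Q\<close>, gives
  \<open>vdm(\<Y>, Q\<^sub>i\<^sub>,\<^sub>:) = (\<Prod>b>0. y\<^sub>b - y\<^sub>0) \<cdot> vdm(\<Y> - {y\<^sub>0}, Q'\<^sub>i\<^sub>,\<^sub>:)\<close>, so the same powers of \<open>y\<^sub>b - y\<^sub>0\<close>
  appear on both sides.

  What remains is the claim for \<open>P\<close> without its first column and for \<open>Q'\<close>, which are
  \<open>m \<times> (n - 1)\<close> matrices. The quotients \<open>q'\<^sub>j\<close> of the \<open>q\<^bsub>j+1\<^esub>\<close> are monic of degree \<open>j\<close>, but they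
  now fill only the strictly lower triangle of \<open>Q'\<close>, while the \<open>p\<^sub>i\<close> fill the upper triangle of
  the truncated \<open>P\<close> including its diagonal. Exchanging the two variables and transposing both matrices
  restores the original pattern, with size \<open>(n - 1) \<times> m\<close>. The condition
  \<open>n \<in> {m, m + 1}\<close> is exactly what this exchange preserves: \<open>(m, m)\<close> goes to \<open>(m - 1, m)\<close> and
  \<open>(m, m + 1)\<close> goes to \<open>(m, m)\<close>. Induction on \<open>m + n\<close> finishes the proof
  (\<open>abs_vdm_product_grid\<close>). No division by a determinant occurs, so neither
  coinciding points nor linearly dependent polynomials need separate treatment.
\<close>

section \<open>Elimination in Vandermonde determinants\<close>

lemma vdm_map: "vdm ev (map h as) (map k fs) = vdm (\<lambda>f a. ev (k f) (h a)) as fs"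
  unfolding vdm_def by (intro arg_cong[where f = det] eq_matI) auto

lemma vdm_cong:
  assumes "\<And>f a. f \<in> set fs \<Longrightarrow> a \<in> set as \<Longrightarrow> ev f a = ev' f a"
  shows "vdm ev as fs = vdm ev' as fs"
  unfolding vdm_def using assms by (intro arg_cong[where f = det] eq_matI) auto

lemma vdm_scale_points:
  assumes "length as = length fs"
  shows "vdm (\<lambda>f a. c a * ev f a) as fs = prod_list (map c as) * vdm ev as fs"
proof -
  let ?N = "length fs"
  have pl: "prod_list (map c as) = (\<Prod>i = 0..<?N. c (as ! i))"
    using assms by (simp add: prod.list_conv_set_nth)
  have perm: "\<pi> i < ?N" if "\<pi> permutes {0..<?N}" "i < ?N" for \<pi> i
    using permutes_in_image[OF that(1), of i] that(2) by simp
  show ?thesis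
    unfolding vdm_def pl using assms
    by (subst (1 2) det_def'[of _ ?N])
       (auto simp: perm prod.distrib sum_distrib_left intro!: sum.cong)
qed

text \<open>
  The functions in \<open>fs1\<close> do not distinguish a point \<open>a\<close> of \<open>as2\<close> from its base point \<open>g a\<close> in
  \<open>as1\<close>, so subtracting the row of \<open>g a\<close> from the row of \<open>a\<close> clears the block in rows \<open>as2\<close> and
  columns \<open>fs1\<close>.
\<close>

lemma vdm_eliminate_block:
  assumes len1: "length as1 = length fs1" and len2: "length as2 = length fs2"
    and base: "\<And>a. a \<in> set as2 \<Longrightarrow> g a \<in> set as1"
    and same: "\<And>f a. f \<in> set fs1 \<Longrightarrow> a \<in> set as2 \<Longrightarrow> ev f a = ev f (g a)"
  shows "vdm ev (as1 @ as2) (fs1 @ fs2) =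
    vdm ev as1 fs1 * vdm (\<lambda>f a. ev f a - ev f (g a)) as2 fs2"
proof -
  let ?n = "length fs1" and ?k = "length fs2"
  have "\<forall>i<?k. \<exists>t<?n. as1 ! t = g (as2 ! i)"
    using base len1 len2 by (metis in_set_conv_nth)
  then obtain t where t: "\<And>i. i < ?k \<Longrightarrow> t i < ?n \<and> as1 ! t i = g (as2 ! i)"
    by metis
  define A where "A = mat ?n ?n (\<lambda>(i, j). ev (fs1 ! j) (as1 ! i))"
  define B where "B = mat ?n ?k (\<lambda>(i, j). ev (fs2 ! j) (as1 ! i))"
  define C where "C = mat ?k ?n (\<lambda>(i, j). ev (fs1 ! j) (as2 ! i))"
  define D where "D = mat ?k ?k (\<lambda>(i, j). ev (fs2 ! j) (as2 ! i))"
  define E where "E = mat ?k ?k (\<lambda>(i, j). ev (fs2 ! j) (as2 ! i) - ev (fs2 ! j) (g (as2 ! i)))"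
  \<comment> \<open>Left multiplication by \<open>K\<close> selects the row of the base point.\<close>
  define K where "K = mat ?k ?n (\<lambda>(i, j). if j = t i then 1 else 0 :: real)"
  note carrier = A_def B_def C_def D_def E_def K_def
  have select: "(K * M) $$ (i, j) = M $$ (t i, j)"
    if "M \<in> carrier_mat ?n l" "i < ?k" "j < l" for M l i j
  proof -
    have "(K * M) $$ (i, j) = (\<Sum>s = 0..<?n. (if s = t i then 1 else 0) * M $$ (s, j))"
      using that by (auto simp: K_def scalar_prod_def intro!: sum.cong)
    also have "\<dots> = (\<Sum>s = 0..<?n. if s = t i then M $$ (s, j) else 0)"
      by (intro sum.cong) auto
    also have "\<dots> = M $$ (t i, j)"
      using t that by simp
    finally show ?thesis .
  qed
  have KA: "K * A = C"
  proof (rule eq_matI)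
    fix i j assume ij: "i < dim_row C" "j < dim_col C"
    then have "ev (fs1 ! j) (as2 ! i) = ev (fs1 ! j) (g (as2 ! i))"
      using same len2 by (simp add: C_def)
    then show "(K * A) $$ (i, j) = C $$ (i, j)"
      using ij t select[of A ?n i j] by (simp add: A_def C_def)
  qed (simp_all add: carrier)
  have KBE: "K * B + E = D"
  proof (rule eq_matI)
    fix i j assume ij: "i < dim_row D" "j < dim_col D"
    then show "(K * B + E) $$ (i, j) = D $$ (i, j)"
      using t select[of B ?k i j] by (simp add: B_def D_def E_def K_def del: index_mult_mat(1))
  qed (simp_all add: carrier)
  let ?L = "four_block_mat (1\<^sub>m ?n) (0\<^sub>m ?n ?k) K (1\<^sub>m ?k)"
  let ?U = "four_block_mat A B (0\<^sub>m ?k ?n) E"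
  have L: "?L \<in> carrier_mat (?n + ?k) (?n + ?k)" and U: "?U \<in> carrier_mat (?n + ?k) (?n + ?k)"
    by (auto simp: carrier)
  have cs: "A \<in> carrier_mat ?n ?n" "B \<in> carrier_mat ?n ?k" "C \<in> carrier_mat ?k ?n"
    "E \<in> carrier_mat ?k ?k" "K \<in> carrier_mat ?k ?n"
    by (simp_all add: carrier)
  have "?L * ?U = four_block_mat A B C D"
    using cs KA KBE
    by (subst mult_four_block_mat[where ?nr1.0 = ?n and ?n1.0 = ?n and ?n2.0 = ?k
          and ?nr2.0 = ?k and ?nc1.0 = ?n and ?nc2.0 = ?k]) auto
  also have "\<dots> = mat (length (as1 @ as2)) (length (fs1 @ fs2))
      (\<lambda>(i, j). ev ((fs1 @ fs2) ! j) ((as1 @ as2) ! i))"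
    using len1 len2 by (intro eq_matI) (auto simp: carrier nth_append)
  finally have "vdm ev (as1 @ as2) (fs1 @ fs2) = det (?L * ?U)"
    by (simp add: vdm_def)
  also have "\<dots> = det ?L * det ?U"
    by (rule det_mult[OF L U])
  also have "det ?L = 1"
    using cs by (subst det_four_block_mat_upper_right_zero[where n = ?n and m = ?k]) auto
  also have "det ?U = det A * det E"
    using cs by (subst det_four_block_mat_lower_left_zero[where n = ?n and m = ?k]) auto
  finally show ?thesis
    using len1 len2 by (simp add: vdm_def A_def E_def)
qed

section \<open>Division by a linear factor\<close>

lemma poly_diff_eq_synthetic_div:
  fixes f :: "'a::comm_ring_1 poly"
  shows "poly f z - poly f c = (z - c) * poly (synthetic_div f c) z"
proof -
  have "poly f z = poly ([:-c, 1:] * synthetic_div f c + [:poly f c:]) z"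
    by (simp only: synthetic_div_correct')
  then show ?thesis
    by (simp add: algebra_simps)
qed

lemma lead_coeff_synthetic_div:
  assumes "degree f \<noteq> 0"
  shows "lead_coeff (synthetic_div f c) = lead_coeff f"
proof -
  let ?s = "synthetic_div f c"
  have deg: "degree ?s = degree f - 1"
    by (rule degree_synthetic_div)
  have "coeff (f + smult c ?s) (degree f) = coeff (pCons (poly f c) ?s) (degree f)"
    by (simp only: synthetic_div_correct)
  moreover have "coeff ?s (degree f) = 0"
    using deg assms by (intro coeff_eq_0) simp
  moreover have "coeff (pCons (poly f c) ?s) (degree f) = coeff ?s (degree f - 1)"
    using assms by (cases "degree f") simp_all
  ultimately show ?thesis
    using deg by simp
qed

text \<open>
  The case of a single base point: the constant function at the head of the list is the block to
  split off.
\<close>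

lemma vdm_divided_difference:
  fixes u :: "nat \<Rightarrow> real poly" and y :: "nat \<Rightarrow> real"
  assumes "u 0 = 1"
  shows "vdm (\<lambda>j b. poly (u j) (y b)) [0..<Suc k] [0..<Suc k] =
    (\<Prod>b\<leftarrow>[0..<k]. y (Suc b) - y 0) *
    vdm (\<lambda>j b. poly (synthetic_div (u (Suc j)) (y 0)) (y (Suc b))) [0..<k] [0..<k]"
proof -
  let ?ev = "\<lambda>j b. poly (u j) (y b)"
  have split: "[0..<Suc k] = [0] @ map Suc [0..<k]"
    by (simp add: map_Suc_upt upt_conv_Cons del: upt_Suc)
  have "vdm ?ev [0..<Suc k] [0..<Suc k] =
      vdm ?ev [0] [0] * vdm (\<lambda>j b. ?ev j b - ?ev j 0) (map Suc [0..<k]) (map Suc [0..<k])"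
    unfolding split by (rule vdm_eliminate_block) (simp_all add: assms)
  also have "vdm ?ev [0] [0] = 1"
    by (simp add: vdm_def assms det_single)
  also have "vdm (\<lambda>j b. ?ev j b - ?ev j 0) (map Suc [0..<k]) (map Suc [0..<k]) =
      vdm (\<lambda>j b. (y (Suc b) - y 0) * poly (synthetic_div (u (Suc j)) (y 0)) (y (Suc b)))
        [0..<k] [0..<k]"
    by (simp add: vdm_map poly_diff_eq_synthetic_div)
  finally show ?thesis
    by (simp add: vdm_scale_points)
qed

section \<open>Vandermonde determinants on a product grid\<close>

text \<open>
  A reordering of the grid that puts the base points \<open>(a, 0)\<close> first and lists the remaining ones
  with exchanged coordinates, so that they again form a grid, of transposed shape.
\<close>

lemma mset_grid_split:
  "mset (List.product [0..<m] [0..<Suc k]) =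
   mset (map (\<lambda>a. (a, 0)) [0..<m] @
     map (\<lambda>(b, a). (a, Suc b)) (List.product [0..<k] [0..<m]))"
proof (subst set_eq_iff_mset_eq_distinct[symmetric])
  show "distinct (List.product [0..<m] [0..<Suc k])"
    by (simp add: distinct_product del: upt_Suc)
  show "distinct (map (\<lambda>a. (a, 0)) [0..<m] @
      map (\<lambda>(b, a). (a, Suc b)) (List.product [0..<k] [0..<m]))"
    by (auto simp: distinct_map distinct_product inj_on_def)
  have "(a, b) \<in> (\<lambda>(b, a). (a, Suc b)) ` ({0..<k} \<times> {0..<m})"
    if "a < m" "b < Suc k" "b \<noteq> 0" for a b
    using that by (cases b) (auto simp: image_iff)
  then show "set (List.product [0..<m] [0..<Suc k]) =
      set (map (\<lambda>a. (a, 0)) [0..<m] @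
        map (\<lambda>(b, a). (a, Suc b)) (List.product [0..<k] [0..<m]))"
    by (auto simp del: upt_Suc) force+
qed

lemma prod_list_product_fst:
  fixes c :: "'a \<Rightarrow> 'c::comm_monoid_mult"
  shows "(\<Prod>(a, b)\<leftarrow>List.product as bs. c a) = (\<Prod>a\<leftarrow>as. c a) ^ length bs"
  by (induction as) (simp_all add: comp_def power_mult_distrib map_replicate_const)

text \<open>
  One elimination step. The right-hand side has transposed shape: \<open>j < k\<close> is now the row index and
  \<open>i < m\<close> the column index.
\<close>

lemma abs_vdm_product_grid_step:
  fixes P Q :: "nat \<Rightarrow> nat \<Rightarrow> real poly" and x y :: "nat \<Rightarrow> real" and m k :: nat
  assumes "\<And>i. i < m \<Longrightarrow> Q i 0 = 1"
  defines "G \<equiv> List.product [0..<m] [0..<Suc k]" and "H \<equiv> List.product [0..<k] [0..<m]"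
  shows "\<bar>vdm (\<lambda>(i, j) (a, b). poly (P i j) (x a) * poly (Q i j) (y b)) G G\<bar> =
    \<bar>vdm (\<lambda>i a. poly (P i 0) (x a)) [0..<m] [0..<m] *
     ((\<Prod>b\<leftarrow>[0..<k]. y (Suc b) - y 0) ^ m *
      vdm (\<lambda>(j, i) (b, a). poly (synthetic_div (Q i (Suc j)) (y 0)) (y (Suc b)) *
        poly (P i (Suc j)) (x a)) H H)\<bar>"
proof -
  let ?ev = "\<lambda>(i, j) (a, b). poly (P i j) (x a) * poly (Q i j) (y b)"
  let ?W1 = "map (\<lambda>a. (a, 0)) [0..<m]"
  let ?W2 = "map (\<lambda>(b, a). (a, Suc b)) H"
  have ms: "mset G = mset (?W1 @ ?W2)"
    unfolding G_def H_def by (rule mset_grid_split)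
  have len: "length (?W1 @ ?W2) = length G"
    using arg_cong[OF ms, of size] by (simp only: size_mset)
  have "\<bar>vdm ?ev G G\<bar> = \<bar>vdm ?ev (?W1 @ ?W2) G\<bar>"
    by (rule abs_vdm_permute_points[OF ms]) simp
  also have "\<dots> = \<bar>vdm ?ev (?W1 @ ?W2) (?W1 @ ?W2)\<bar>"
    by (rule abs_vdm_permute_polys[OF ms len])
  also have "vdm ?ev (?W1 @ ?W2) (?W1 @ ?W2) = vdm ?ev ?W1 ?W1 *
      vdm (\<lambda>f z. ?ev f z - ?ev f ((\<lambda>(a, b). (a, 0)) z)) ?W2 ?W2"
    by (rule vdm_eliminate_block) (auto simp: H_def assms(1))
  also have "vdm ?ev ?W1 ?W1 = vdm (\<lambda>i a. poly (P i 0) (x a)) [0..<m] [0..<m]"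
    unfolding vdm_map by (rule vdm_cong) (simp add: assms(1))
  also have "vdm (\<lambda>f z. ?ev f z - ?ev f ((\<lambda>(a, b). (a, 0)) z)) ?W2 ?W2 =
      vdm (\<lambda>f z. (case z of (b, a) \<Rightarrow> y (Suc b) - y 0) *
        (case (f, z) of ((j, i), (b, a)) \<Rightarrow>
          poly (synthetic_div (Q i (Suc j)) (y 0)) (y (Suc b)) * poly (P i (Suc j)) (x a))) H H"
    unfolding vdm_map
    by (rule vdm_cong)
       (auto simp: right_diff_distrib[symmetric] poly_diff_eq_synthetic_div mult_ac)
  also have "\<dots> = (\<Prod>(b, a)\<leftarrow>H. y (Suc b) - y 0) *
      vdm (\<lambda>f z. (case (f, z) of ((j, i), (b, a)) \<Rightarrow>
          poly (synthetic_div (Q i (Suc j)) (y 0)) (y (Suc b)) * poly (P i (Suc j)) (x a))) H H"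
    by (rule vdm_scale_points) simp
  also have "(\<Prod>(b, a)\<leftarrow>H. y (Suc b) - y 0) = (\<Prod>b\<leftarrow>[0..<k]. y (Suc b) - y 0) ^ m"
    unfolding H_def prod_list_product_fst by simp
  finally show ?thesis
    by (simp add: case_prod_unfold)
qed

text \<open>
  The induction includes the degenerate case \<open>m = 0\<close>, where all determinants are empty; this is
  where the alternation \<open>(m, m + 1)\<close>, \<open>(m, m)\<close>, \<open>(m - 1, m)\<close> ends.
\<close>

lemma abs_vdm_product_grid:
  fixes P Q :: "nat \<Rightarrow> nat \<Rightarrow> real poly" and x y :: "nat \<Rightarrow> real" and p q :: "nat \<Rightarrow> real poly"
  assumes "n = m \<or> n = m + 1"
    and "\<And>j. j < m \<Longrightarrow> lead_coeff (q j) = 1 \<and> degree (q j) = j"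
    and "\<And>j. j + 1 < n \<Longrightarrow> lead_coeff (p j) = 1 \<and> degree (p j) = j"
    and "\<And>i j. i < m \<Longrightarrow> j \<le> i \<Longrightarrow> Q i j = q j"
    and "\<And>i j. i < m \<Longrightarrow> i < j \<Longrightarrow> j < n \<Longrightarrow> P i j = p i"
  shows "\<bar>vdm (\<lambda>(i, j) (a, b). poly (P i j) (x a) * poly (Q i j) (y b))
      (List.product [0..<m] [0..<n]) (List.product [0..<m] [0..<n])\<bar> =
    \<bar>(\<Prod>j<n. vdm (\<lambda>i a. poly (P i j) (x a)) [0..<m] [0..<m]) *
     (\<Prod>i<m. vdm (\<lambda>j b. poly (Q i j) (y b)) [0..<n] [0..<n])\<bar>"
  using assms
proof (induction "m + n" arbitrary: m n P Q x y p q rule: less_induct)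
  case less
  show ?case
  proof (cases "m = 0")
    case True
    then show ?thesis
      by (simp add: vdm_def)
  next
    case False
    then obtain k where n: "n = Suc k"
      using less.prems(1) by (cases n) auto
    define Q' where "Q' j i = synthetic_div (Q i (Suc j)) (y 0)" for j i
    define q' where "q' j = synthetic_div (q (Suc j)) (y 0)" for j
    have q0: "lead_coeff (q 0) = 1 \<and> degree (q 0) = 0"
      using False by (intro less.prems(2)) simp
    then obtain c where "q 0 = [:c:]"
      by (auto elim: degree_eq_zeroE)
    with q0 have "q 0 = 1"
      by (simp add: one_pCons)
    then have Q0: "Q i 0 = 1" if "i < m" for i
      using less.prems(4)[of i 0] that by simp
    have q': "lead_coeff (q' j) = 1 \<and> degree (q' j) = j" if "j + 1 < m" for j
    proof -
      have q: "lead_coeff (q (Suc j)) = 1 \<and> degree (q (Suc j)) = Suc j"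
        using that by (intro less.prems(2)) simp
      then have "lead_coeff (q' j) = 1"
        unfolding q'_def by (subst lead_coeff_synthetic_div) auto
      with q show ?thesis
        by (simp add: q'_def degree_synthetic_div)
    qed
    let ?d = "\<Prod>b\<leftarrow>[0..<k]. y (Suc b) - y 0"
    let ?V = "\<lambda>j. vdm (\<lambda>i a. poly (P i j) (x a)) [0..<m] [0..<m]"
    let ?W = "\<lambda>i. vdm (\<lambda>j b. poly (Q' j i) (y (Suc b))) [0..<k] [0..<k]"
    have IH: "\<bar>vdm (\<lambda>(j, i) (b, a). poly (Q' j i) (y (Suc b)) * poly (P i (Suc j)) (x a))
        (List.product [0..<k] [0..<m]) (List.product [0..<k] [0..<m])\<bar> =
        \<bar>(\<Prod>i<m. ?W i) * (\<Prod>j<k. ?V (Suc j))\<bar>"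
    proof (rule less.hyps[where P = Q' and Q = "\<lambda>j i. P i (Suc j)" and p = q' and q = p
          and x = "\<lambda>b. y (Suc b)" and y = x])
      show "k + m < m + n" "m = k \<or> m = k + 1"
        using n less.prems(1) by auto
      show "lead_coeff (q' j) = 1 \<and> degree (q' j) = j" if "j + 1 < m" for j
        by (rule q'[OF that])
      show "lead_coeff (p j) = 1 \<and> degree (p j) = j" if "j < k" for j
        by (rule less.prems(3)) (use that n in simp)
      show "P i (Suc j) = p i" if "j < k" "i \<le> j" for j i
        using less.prems(5)[of i "Suc j"] less.prems(1) that n by auto
      show "Q' j i = q' j" if "j < k" "j < i" "i < m" for j i
        using less.prems(4)[of i "Suc j"] that by (simp add: Q'_def q'_def)
    qed
    have "(\<Prod>i<m. vdm (\<lambda>j b. poly (Q i j) (y b)) [0..<n] [0..<n]) = (\<Prod>i<m. ?d * ?W i)"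
      unfolding n by (intro prod.cong refl) (simp add: vdm_divided_difference Q0 Q'_def del: upt_Suc)
    then have rows: "(\<Prod>i<m. vdm (\<lambda>j b. poly (Q i j) (y b)) [0..<n] [0..<n]) =
        ?d ^ m * (\<Prod>i<m. ?W i)"
      by (simp add: prod.distrib)
    have cols: "(\<Prod>j<n. ?V j) = ?V 0 * (\<Prod>j<k. ?V (Suc j))"
      unfolding n by (rule prod.lessThan_Suc_shift)
    have "\<bar>vdm (\<lambda>(i, j) (a, b). poly (P i j) (x a) * poly (Q i j) (y b))
        (List.product [0..<m] [0..<n]) (List.product [0..<m] [0..<n])\<bar> =
        \<bar>?V 0 * (?d ^ m *
          vdm (\<lambda>(j, i) (b, a). poly (Q' j i) (y (Suc b)) * poly (P i (Suc j)) (x a))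
            (List.product [0..<k] [0..<m]) (List.product [0..<k] [0..<m]))\<bar>"
      unfolding n Q'_def by (rule abs_vdm_product_grid_step) (rule Q0)
    also have "\<dots> = \<bar>?V 0\<bar> * (\<bar>?d ^ m\<bar> * \<bar>(\<Prod>i<m. ?W i) * (\<Prod>j<k. ?V (Suc j))\<bar>)"
      by (simp only: abs_mult[of "?V 0"] abs_mult[of "?d ^ m"] IH)
    also have "\<dots> = \<bar>(?V 0 * (\<Prod>j<k. ?V (Suc j))) * (?d ^ m * (\<Prod>i<m. ?W i))\<bar>"
      by (simp only: abs_mult mult_ac)
    finally show ?thesis
      unfolding rows cols .
  qed
qed

section \<open>Hadamard products of polynomial matrices\<close>

lemma mat_entries_conv_product:
  "mat_entries R = map (\<lambda>ij. R $$ ij) (List.product [0..<dim_row R] [0..<dim_col R])"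
  by (simp add: mat_entries_def mat_to_list_def product_concat_map map_concat comp_def)

lemma product_conv_nth:
  "List.product xs ys =
    map (\<lambda>(a, b). (xs ! a, ys ! b)) (List.product [0..<length xs] [0..<length ys])"
proof -
  have "List.product (map f as) (map g bs) = map (\<lambda>(a, b). (f a, g b)) (List.product as bs)"
    for f :: "nat \<Rightarrow> 'a" and g :: "nat \<Rightarrow> 'b" and as bs
    by (induction as) (simp_all add: comp_def)
  from this[of "(!) xs" "[0..<length xs]" "(!) ys" "[0..<length ys]"] show ?thesis
    by (simp add: map_nth)
qed

lemma vdm_list_of_vec:
  assumes "length as = N" "dim_vec v = N"
  shows "vdm ev as (list_of_vec v) = vdm (\<lambda>j b. ev (v $ j) (as ! b)) [0..<N] [0..<N]"
  unfolding vdm_def using assms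
  by (intro arg_cong[where f = det] eq_matI) (auto simp: list_of_vec_index)

theorem proposition1:
  fixes m n :: nat
    and q p :: "nat \<Rightarrow> real poly"
    and P Q :: "real poly mat"
    and xs ys :: "real list"
  assumes "m \<ge> 1" and "n \<ge> 1"
    and "n = m \<or> n = m + 1"
    and "\<And>j. j < m \<Longrightarrow> lead_coeff (q j) = 1 \<and> degree (q j) = j"
    and "\<And>j. j + 1 < n \<Longrightarrow> lead_coeff (p j) = 1 \<and> degree (p j) = j"
    and "P \<in> carrier_mat m n" and "Q \<in> carrier_mat m n"
    and "\<And>i j. i < m \<Longrightarrow> j \<le> i \<Longrightarrow> Q $$ (i, j) = q j"
    and "\<And>i j. i < m \<Longrightarrow> i < j \<Longrightarrow> j < n \<Longrightarrow> P $$ (i, j) = p i"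
    and "length xs = m" and "length ys = n"
  shows "\<bar>vdm poly_xy (List.product xs ys) (mat_entries (hadamard_xy P Q))\<bar> =
    \<bar>(\<Prod>j<n. vdm poly xs (list_of_vec (col P j))) *
     (\<Prod>i<m. vdm poly ys (list_of_vec (row Q i)))\<bar>"
proof -
  let ?G = "List.product [0..<m] [0..<n]"
  have dims: "dim_row P = m" "dim_col P = n" "dim_row Q = m" "dim_col Q = n"
    using assms(6,7) by auto
  have entries: "mat_entries (hadamard_xy P Q) = map (\<lambda>ij. hadamard_xy P Q $$ ij) ?G"
    by (simp add: mat_entries_conv_product hadamard_xy_def dims)
  have points: "List.product xs ys = map (\<lambda>(a, b). (xs ! a, ys ! b)) ?G"
    using product_conv_nth[of xs ys] assms(10,11) by simp
  have "vdm poly_xy (List.product xs ys) (mat_entries (hadamard_xy P Q)) =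
      vdm (\<lambda>(i, j) (a, b). poly (P $$ (i, j)) (xs ! a) * poly (Q $$ (i, j)) (ys ! b)) ?G ?G"
    unfolding entries points vdm_map
    by (rule vdm_cong) (auto simp: hadamard_xy_def dims poly_xy_in_x_mult_in_y)
  also have "\<bar>\<dots>\<bar> =
      \<bar>(\<Prod>j<n. vdm (\<lambda>i a. poly (P $$ (i, j)) (xs ! a)) [0..<m] [0..<m]) *
       (\<Prod>i<m. vdm (\<lambda>j b. poly (Q $$ (i, j)) (ys ! b)) [0..<n] [0..<n])\<bar>"
    by (rule abs_vdm_product_grid[OF assms(3-5,8,9)])
  also have "(\<Prod>j<n. vdm (\<lambda>i a. poly (P $$ (i, j)) (xs ! a)) [0..<m] [0..<m]) =
      (\<Prod>j<n. vdm poly xs (list_of_vec (col P j)))"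
    using assms(10) by (intro prod.cong refl)
      (auto simp: vdm_list_of_vec[of _ m] dims intro!: vdm_cong)
  also have "(\<Prod>i<m. vdm (\<lambda>j b. poly (Q $$ (i, j)) (ys ! b)) [0..<n] [0..<n]) =
      (\<Prod>i<m. vdm poly ys (list_of_vec (row Q i)))"
    using assms(11) by (intro prod.cong refl)
      (auto simp: vdm_list_of_vec[of _ n] dims intro!: vdm_cong)
  finally show ?thesis .
qed

end
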